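(* Let $N\in\mathbb{N}$ and $\Delta t=1/N$. Then: (a) There exist $C>0$ and $\rho>0$, independent of $\phi$ and of $\tau$, such that $$\sup_{\tau\in\mathbb{T},\,\mathbf{x}\in\tilde Y}\Big|\big((I_{\Delta t})^{N}\big)^n\phi(\tau,\mathbf{x})-\int_{\tilde Y}\phi(\tau,\mathbf{x}')\,\pi_\tau(\mathrm{d}\mathbf{x}')\Big|\le C\|\phi\|_{L^\infty}e^{-\rho n}\qquad\forall\phi\in\mathcal{B}(\mathbb{T}\times\tilde Y),\ \forall n\in\mathbb{N}.$$ (b) If $\phi\in\mathcal{B}(\mathbb{T}\times\tilde Y)$ satisfies $\int_{\tilde Y}\phi(s,\mathbf{x})\,\pi_s(\mathrm{d}\mathbf{x})=0$ for all $s\in\mathbb{T}$, then for every $\tau\in\mathbb{T}$ and every starting point, the series $\sum_{i=1}^{\infty}\mathbb{E}\,\phi(\tau+i\Delta t,\mathbf{X}^{i})$, with $\mathbf{X}^i$ the chain started at time $\tau$, converges (its partial sums have a finite limit). (c) The kernel of $I_d-(I_{\Delta t})^N$ on $\mathcal{B}(\mathbb{T}\times\tilde Y)$ is exactly the set of functions $w(\tau,\mathbf{x})=c(\tau)$ depending only on $\tau$, with $c$ $1$-periodic.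
   Context: Let $\mathbb{T}=\mathbb{R}/\mathbb{Z}$ (time torus) and $\tilde Y=\mathbb{R}^2/\mathbb{Z}^2$ (spatial torus). Let $\sigma>0$. Let $v_1(t,x_2)$ and $v_2(t,x_1)$ be smooth real functions, $1$-periodic in each argument (so $v_1$ does not depend on $x_1$ and $v_2$ does not depend on $x_2$), with $\int_0^1 v_1(t,x_2)\,\mathrm{d}x_2=0$ for all $t$ and $\int_0^1 v_2(t,x_1)\,\mathrm{d}x_1=0$ for all $t$. Let $N\in\mathbb{N}$ and $\Delta t=1/N$. For a starting time $\tau\in\mathbb{R}$ and starting point $\mathbf{X}^0=(x_1^0,x_2^0)$, the numerical scheme generates the Markov chain $\mathbf{X}^n=(x_1^n,x_2^n)$ by $$x_1^{n+1}=x_1^n+v_1(\tau+(n+\tfrac12)\Delta t,x_2^n)\Delta t+\sigma\sqrt{\Delta t}\,\xi_1^n,$$ $$x_2^{n+1}=x_2^n+v_2\big(\tau+(n+\tfrac12)\Delta t,\;x_1^n+v_1(\tau+(n+\tfrac12)\Delta t,x_2^n)\Delta t\big)\Delta t+\sigma\sqrt{\Delta t}\,\xi_2^n,$$ where $\xi_1^n,\xi_2^n$ are i.i.d. $\mathcal{N}(0,1)$. By periodicity the chain is well defined on $\tilde Y$. $\mathcal{B}(S)$ is the space of bounded measurable functions on $S$. The one-step space-time operator $I_{\Delta t}$ on $\mathcal{B}(\mathbb{T}\times\tilde Y)$ is $(I_{\Delta t}\phi)(\tau,\mathbf{x})=\mathbb{E}[\phi(\tau+\Delta t,\mathbf{X}^1)\mid\mathbf{X}^0=\mathbf{x}]$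 for the chain started at time $\tau$; thus $((I_{\Delta t})^N\phi)(\tau,\cdot)=I_{\tau,1+\tau}\phi(\tau,\cdot)$, where $(I_{\tau,1+\tau}\psi)(\mathbf{x})=\mathbb{E}[\psi(\mathbf{X}^N)\mid\mathbf{X}^0=\mathbf{x}]$ (chain started at time $\tau$). For each $\tau$, $\pi_\tau$ denotes the unique invariant probability measure of $I_{\tau,1+\tau}$ on $\tilde Y$. *)

theory Defs
  imports "HOL-Probability.Probability"
begin

definition pd1 :: "(real \<Rightarrow> real \<Rightarrow> real) \<Rightarrow> real \<Rightarrow> real \<Rightarrow> real" where
  "pd1 f = (\<lambda>a b. deriv (\<lambda>s. f s b) a)"

definition pd2 :: "(real \<Rightarrow> real \<Rightarrow> real) \<Rightarrow> real \<Rightarrow> real \<Rightarrow> real" where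
  "pd2 f = (\<lambda>a b. deriv (\<lambda>s. f a s) b)"

fun iter_pd :: "bool list \<Rightarrow> (real \<Rightarrow> real \<Rightarrow> real) \<Rightarrow> real \<Rightarrow> real \<Rightarrow> real" where
  "iter_pd [] f = f"
| "iter_pd (b # bs) f = (if b then pd1 else pd2) (iter_pd bs f)"

definition smooth2 :: "(real \<Rightarrow> real \<Rightarrow> real) \<Rightarrow> bool" where
  "smooth2 f \<longleftrightarrow> (\<forall>bs z. (\<lambda>p. iter_pd bs f (fst p) (snd p)) differentiable (at z))"

definition gauss2 :: "(real \<times> real) measure" where
  "gauss2 = density lborel std_normal_density \<Otimes>\<^sub>M density lborel std_normal_density"

definition step :: "(real \<Rightarrow> real \<Rightarrow> real) \<Rightarrow> (real \<Rightarrow> real \<Rightarrow> real) \<Rightarrow> real \<Rightarrow> nat \<Rightarrow>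
    real \<Rightarrow> nat \<Rightarrow> real \<times> real \<Rightarrow> real \<times> real \<Rightarrow> real \<times> real" where
  "step v1 v2 \<sigma> N \<tau> n x \<xi> =
    (let dt = 1 / real N;
         t = \<tau> + (real n + 1/2) * dt;
         y1 = fst x + v1 t (snd x) * dt
     in (y1 + \<sigma> * sqrt dt * fst \<xi>,
         snd x + v2 t y1 * dt + \<sigma> * sqrt dt * snd \<xi>))"

primrec chain :: "(real \<Rightarrow> real \<Rightarrow> real) \<Rightarrow> (real \<Rightarrow> real \<Rightarrow> real) \<Rightarrow> real \<Rightarrow> nat \<Rightarrow>
    real \<Rightarrow> real \<times> real \<Rightarrow> (nat \<Rightarrow> real \<times> real) \<Rightarrow> nat \<Rightarrow> real \<times> real" where
  "chain v1 v2 \<sigma> N \<tau> x \<xi> 0 = x"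
| "chain v1 v2 \<sigma> N \<tau> x \<xi> (Suc n) = step v1 v2 \<sigma> N \<tau> n (chain v1 v2 \<sigma> N \<tau> x \<xi> n) (\<xi> n)"

definition noise :: "nat \<Rightarrow> (nat \<Rightarrow> real \<times> real) measure" where
  "noise i = PiM {..<i} (\<lambda>_. gauss2)"

definition chain_exp :: "(real \<Rightarrow> real \<Rightarrow> real) \<Rightarrow> (real \<Rightarrow> real \<Rightarrow> real) \<Rightarrow> real \<Rightarrow> nat \<Rightarrow>
    real \<Rightarrow> real \<times> real \<Rightarrow> nat \<Rightarrow> (real \<times> real \<Rightarrow> real) \<Rightarrow> real" where
  "chain_exp v1 v2 \<sigma> N \<tau> x i \<psi> = (\<integral>\<xi>. \<psi> (chain v1 v2 \<sigma> N \<tau> x \<xi> i) \<partial>noise i)"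

definition Idt :: "(real \<Rightarrow> real \<Rightarrow> real) \<Rightarrow> (real \<Rightarrow> real \<Rightarrow> real) \<Rightarrow> real \<Rightarrow> nat \<Rightarrow>
    (real \<Rightarrow> real \<times> real \<Rightarrow> real) \<Rightarrow> real \<Rightarrow> real \<times> real \<Rightarrow> real" where
  "Idt v1 v2 \<sigma> N \<phi> \<tau> x = (\<integral>\<xi>. \<phi> (\<tau> + 1 / real N) (step v1 v2 \<sigma> N \<tau> 0 x \<xi>) \<partial>gauss2)"

definition Iper :: "(real \<Rightarrow> real \<Rightarrow> real) \<Rightarrow> (real \<Rightarrow> real \<Rightarrow> real) \<Rightarrow> real \<Rightarrow> nat \<Rightarrow>
    real \<Rightarrow> (real \<times> real \<Rightarrow> real) \<Rightarrow> real \<times> real \<Rightarrow> real" where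
  "Iper v1 v2 \<sigma> N \<tau> \<psi> x = chain_exp v1 v2 \<sigma> N \<tau> x N \<psi>"

section \<open>Function spaces on the tori (functions on R resp. R^2, 1-periodic)\<close>

definition BY :: "(real \<times> real \<Rightarrow> real) set" where
  "BY = {\<psi>. \<psi> \<in> borel_measurable borel \<and> bounded (range \<psi>) \<and>
            (\<forall>a b. \<psi> (a + 1, b) = \<psi> (a, b) \<and> \<psi> (a, b + 1) = \<psi> (a, b))}"

definition BTY :: "(real \<Rightarrow> real \<times> real \<Rightarrow> real) set" where
  "BTY = {\<phi>. (\<lambda>p. \<phi> (fst p) (snd p)) \<in> borel_measurable borel \<and>
             bounded (range (\<lambda>p. \<phi> (fst p) (snd p))) \<and>
             (\<forall>\<tau> x. \<phi> (\<tau> + 1) x = \<phi> \<tau> x) \<and>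
             (\<forall>\<tau> a b. \<phi> \<tau> (a + 1, b) = \<phi> \<tau> (a, b) \<and> \<phi> \<tau> (a, b + 1) = \<phi> \<tau> (a, b))}"

definition supnorm :: "(real \<Rightarrow> real \<times> real \<Rightarrow> real) \<Rightarrow> real" where
  "supnorm \<phi> = (SUP p. \<bar>\<phi> (fst p) (snd p)\<bar>)"

text \<open>Probability measures on the torus Y~, represented on the fundamental domain [0,1)^2.\<close>
definition torus_prob :: "(real \<times> real) measure \<Rightarrow> bool" where
  "torus_prob \<mu> \<longleftrightarrow> prob_space \<mu> \<and> sets \<mu> = sets borel \<and>
       measure \<mu> ({0..<1} \<times> {0..<1}) = 1"

definition invariant :: "(real \<Rightarrow> real \<Rightarrow> real) \<Rightarrow> (real \<Rightarrow> real \<Rightarrow> real) \<Rightarrow> real \<Rightarrow> nat \<Rightarrow>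
    real \<Rightarrow> (real \<times> real) measure \<Rightarrow> bool" where
  "invariant v1 v2 \<sigma> N \<tau> \<mu> \<longleftrightarrow>
     (\<forall>\<psi>\<in>BY. (\<integral>x. Iper v1 v2 \<sigma> N \<tau> \<psi> x \<partial>\<mu>) = (\<integral>x. \<psi> x \<partial>\<mu>))"

definition pi_inv :: "(real \<Rightarrow> real \<Rightarrow> real) \<Rightarrow> (real \<Rightarrow> real \<Rightarrow> real) \<Rightarrow> real \<Rightarrow> nat \<Rightarrow>
    real \<Rightarrow> (real \<times> real) measure" where
  "pi_inv v1 v2 \<sigma> N \<tau> = (THE \<mu>. torus_prob \<mu> \<and> invariant v1 v2 \<sigma> N \<tau> \<mu>)"

end

theory Submission
  imports Defs
begin

text \<open>
  One step of the scheme adds a nondegenerate Gaussian to a deterministic point. Wrapped around the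
  torus, the density of this Gaussian is bounded below by some \<open>\<delta> > 0\<close>, whatever the point is. This
  is Doeblin's condition relative to the uniform distribution: one step shrinks the length of an
  interval containing the range of a bounded periodic function by the factor
  \<open>1 - \<delta> \<le> exp (- \<delta>)\<close>, uniformly in the time. Hence the laws of the chain after whole periods
  converge uniformly over Borel sets; the limit is the unique invariant measure, and the rate is
  geometric. Centred observables decay geometrically, so their series converges, and a function
  fixed by the period operator has a range of length \<open>0\<close> at each time.
\<close>

section \<open>Lower bounds for the wrapped Gaussian on the circle\<close>

lemma std_normal_density_antimono:
  assumes "\<bar>x\<bar> \<le> \<bar>y\<bar>"
  shows "std_normal_density y \<le> std_normal_density x"
proof -
  have "x\<^sup>2 \<le> y\<^sup>2" using assms by (simp add: abs_le_square_iff)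
  then show ?thesis by (simp add: normal_density_def divide_right_mono)
qed

lemma periodic_add_of_int:
  fixes f :: "real \<Rightarrow> 'a"
  assumes "\<And>x. f (x + 1) = f x"
  shows "f (x + of_int k) = f x"
proof (induction k rule: int_induct[where k=0])
  case base
  then show ?case by simp
next
  case (step1 i)
  then show ?case using assms[of "x + of_int i"] by (simp add: add.assoc)
next
  case (step2 i)
  then show ?case using assms[of "x + of_int (i - 1)"] by (simp add: algebra_simps)
qed

text \<open>Keeping only the translate of \<open>{0..<1}\<close> by \<open>\<lfloor>m\<rfloor>\<close>, which lies within distance \<open>1\<close> of the
  mean \<open>m\<close>, makes the bound independent of \<open>m\<close>.\<close>
lemma nn_integral_periodic_normal_ge:
  fixes f :: "real \<Rightarrow> ennreal"
  assumes [measurable]: "f \<in> borel_measurable borel"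
    and per: "\<And>x. f (x + 1) = f x" and a: "a > 0"
  shows "ennreal (std_normal_density (1 / a) / a) * (\<integral>\<^sup>+y. f y \<partial>density lborel (indicator {0..<1}))
    \<le> (\<integral>\<^sup>+z. f (m + a * z) \<partial>density lborel std_normal_density)"
proof -
  define k where "k = \<lfloor>m\<rfloor>"
  have k: "of_int k \<le> m" "m < of_int k + 1"
    unfolding k_def by linarith+
  have "ennreal (std_normal_density (1 / a) / a) * (\<integral>\<^sup>+y. f y \<partial>density lborel (indicator {0..<1}))
      = ennreal (1 / a) * (\<integral>\<^sup>+y. ennreal (std_normal_density (1 / a)) * (indicator {0..<1} y * f y) \<partial>lborel)"
  proof -
    have "ennreal (std_normal_density (1 / a) / a) = ennreal (1 / a) * ennreal (std_normal_density (1 / a))"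
      using a by (simp flip: ennreal_mult)
    then show ?thesis by (simp add: nn_integral_density nn_integral_cmult mult.assoc)
  qed
  also have "\<dots> \<le> ennreal (1 / a) * (\<integral>\<^sup>+y. ennreal (std_normal_density ((y + k - m) / a)) * f y \<partial>lborel)"
  proof (intro mult_left_mono nn_integral_mono)
    fix y :: real
    have "std_normal_density (1 / a) \<le> std_normal_density ((y + k - m) / a)" if "y \<in> {0..<1}"
    proof (rule std_normal_density_antimono)
      have "\<bar>y + k - m\<bar> \<le> 1" using that k by auto
      then show "\<bar>(y + k - m) / a\<bar> \<le> \<bar>1 / a\<bar>"
        using a by (simp add: abs_divide divide_right_mono)
    qed
    then show "ennreal (std_normal_density (1 / a)) * (indicator {0..<1} y * f y)
        \<le> ennreal (std_normal_density ((y + k - m) / a)) * f y"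
      by (auto simp: indicator_def intro!: mult_right_mono ennreal_leI)
  qed auto
  also have "\<dots> = ennreal (1 / a) * (\<integral>\<^sup>+y. ennreal (std_normal_density ((k - m) / a + 1 / a * y))
      * f (m + a * ((k - m) / a + 1 / a * y)) \<partial>lborel)"
  proof -
    have "m + a * ((k - m) / a + 1 / a * y) = y + k" "(y + k - m) / a = (k - m) / a + 1 / a * y" for y :: real
      using a by (auto simp: field_simps)
    then show ?thesis
      using periodic_add_of_int[of f, OF per] by simp
  qed
  \<comment> \<open>Read from right to left, this is the substitution
    \<open>z = (k - m + y) / a\<close>, with Jacobian \<open>1 / a\<close>.\<close>
  also have "\<dots> = (\<integral>\<^sup>+z. ennreal (std_normal_density z) * f (m + a * z) \<partial>lborel)"
    using a by (subst (2) nn_integral_real_affine[where c="1 / a" and t="(k - m) / a"]) auto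
  also have "\<dots> = (\<integral>\<^sup>+z. f (m + a * z) \<partial>density lborel std_normal_density)"
    by (simp add: nn_integral_density)
  finally show ?thesis .
qed

section \<open>Gaussian and uniform measures in two dimensions\<close>

lemma prob_space_std_normal: "prob_space (density lborel std_normal_density)"
  by (rule prob_space_normal_density) simp

lemma prob_space_pair_measure:
  assumes "prob_space M" "prob_space M'"
  shows "prob_space (M \<Otimes>\<^sub>M M')"
proof -
  interpret M: prob_space M by fact
  interpret M': prob_space M' by fact
  interpret pair_prob_space M M' ..
  show ?thesis by unfold_locales
qed

lemma prob_space_gauss2: "prob_space gauss2"
  unfolding gauss2_def by (intro prob_space_pair_measure prob_space_std_normal)

lemma sets_gauss2 [measurable_cong, simp]: "sets gauss2 = sets borel"
proof -
  have "sets gauss2 = sets (borel \<Otimes>\<^sub>M borel :: (real \<times> real) measure)"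
    unfolding gauss2_def by (intro sets_pair_measure_cong) auto
  then show ?thesis by (metis borel_prod)
qed

lemma space_gauss2 [simp]: "space gauss2 = UNIV"
  using sets_eq_imp_space_eq[OF sets_gauss2] by simp

text \<open>The reference measure of Doeblin's condition: Haar measure of the torus, carried by the
  unit square.\<close>

definition unif2 :: "(real \<times> real) measure" where
  "unif2 = density lborel (indicator {0..<1}) \<Otimes>\<^sub>M density lborel (indicator {0..<1})"

lemma sets_unif2 [measurable_cong, simp]: "sets unif2 = sets borel"
proof -
  have "sets unif2 = sets (borel \<Otimes>\<^sub>M borel :: (real \<times> real) measure)"
    unfolding unif2_def by (intro sets_pair_measure_cong) auto
  then show ?thesis by (metis borel_prod)
qed

lemma space_unif2 [simp]: "space unif2 = UNIV"
  using sets_eq_imp_space_eq[OF sets_unif2] by simp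

lemma prob_space_unif1: "prob_space (density lborel (indicator {0..<1::real}))"
  by (intro prob_spaceI) (simp add: emeasure_density)

lemma prob_space_unif2: "prob_space unif2"
  unfolding unif2_def
  by (intro prob_space_pair_measure prob_space_unif1)

text \<open>Tonelli reduces this to the circle: the one-dimensional bound is applied to the second
  coordinate with the first one fixed, then to the first, since the inner integral is still periodic
  in it. Each use contributes one factor of the constant.\<close>

lemma nn_integral_gauss2_ge:
  fixes f :: "real \<times> real \<Rightarrow> ennreal"
  assumes f: "f \<in> borel_measurable borel"
    and per1: "\<And>x y. f (x + 1, y) = f (x, y)" and per2: "\<And>x y. f (x, y + 1) = f (x, y)" and a: "a > 0"
  shows "ennreal ((std_normal_density (1 / a) / a)\<^sup>2) * (\<integral>\<^sup>+y. f y \<partial>unif2)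
    \<le> (\<integral>\<^sup>+z. f (m1 + a * fst z, m2 + a * snd z) \<partial>gauss2)"
proof -
  let ?G = "density lborel std_normal_density" and ?U = "density lborel (indicator {0..<1::real})"
  let ?c = "std_normal_density (1 / a) / a"
  interpret G: prob_space ?G by (rule prob_space_std_normal)
  interpret U: prob_space ?U by (rule prob_space_unif1)
  have f' [measurable]: "f \<in> borel_measurable (borel \<Otimes>\<^sub>M borel)"
    using f by (simp add: borel_prod)
  have "ennreal (?c\<^sup>2) * (\<integral>\<^sup>+y. f y \<partial>unif2) = ennreal ?c * (ennreal ?c * (\<integral>\<^sup>+x. \<integral>\<^sup>+y. f (x, y) \<partial>?U \<partial>?U))"
  proof -
    have "ennreal (?c\<^sup>2) = ennreal ?c * ennreal ?c"
      unfolding power2_eq_square using a by (intro ennreal_mult) auto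
    then show ?thesis
      unfolding unif2_def by (subst U.nn_integral_fst[symmetric]) (auto simp: mult.assoc)
  qed
  also have "\<dots> = ennreal ?c * (\<integral>\<^sup>+x. ennreal ?c * (\<integral>\<^sup>+y. f (x, y) \<partial>?U) \<partial>?U)"
    by (subst nn_integral_cmult) auto
  also have "\<dots> \<le> ennreal ?c * (\<integral>\<^sup>+x. (\<integral>\<^sup>+z. f (x, m2 + a * z) \<partial>?G) \<partial>?U)"
    by (intro mult_left_mono nn_integral_mono nn_integral_periodic_normal_ge a per2) auto
  also have "\<dots> \<le> (\<integral>\<^sup>+w. (\<integral>\<^sup>+z. f (m1 + a * w, m2 + a * z) \<partial>?G) \<partial>?G)"
    by (intro nn_integral_periodic_normal_ge[where f="\<lambda>x. (\<integral>\<^sup>+z. f (x, m2 + a * z) \<partial>?G)"] a)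
       (auto simp: per1)
  also have "\<dots> = (\<integral>\<^sup>+z. f (m1 + a * fst z, m2 + a * snd z) \<partial>gauss2)"
    unfolding gauss2_def by (subst G.nn_integral_fst[symmetric]) auto
  finally show ?thesis .
qed

section \<open>Uniform closeness on sets: integrals and limits\<close>

lemma (in prob_space) integral_bounds:
  fixes f :: "'a \<Rightarrow> real"
  assumes "f \<in> borel_measurable M" "\<And>x. x \<in> space M \<Longrightarrow> l \<le> f x" "\<And>x. x \<in> space M \<Longrightarrow> f x \<le> u"
  shows "integrable M f" "l \<le> integral\<^sup>L M f" "integral\<^sup>L M f \<le> u"
proof -
  show i: "integrable M f"
    using assms by (intro integrable_const_bound[where B="max \<bar>l\<bar> \<bar>u\<bar>"] AE_I2) fastforce+
  show "l \<le> integral\<^sup>L M f" "integral\<^sup>L M f \<le> u"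
    using assms i by (auto intro!: integral_ge_const integral_le_const)
qed

text \<open>A layer-cake argument: \<open>f\<close> is nearly the average of the indicators of its
  \<open>k\<close> superlevel sets. Each of them contributes at most \<open>e / k\<close> to the
  difference of the integrals, so the number of levels cancels and \<open>e\<close> survives without
  loss.\<close>

lemma prob_distance_integral:
  fixes f :: "'a \<Rightarrow> real"
  assumes M: "prob_space M" and M': "prob_space M'" and sets: "sets M' = sets M"
    and f: "f \<in> borel_measurable M" and f01: "\<And>x. 0 \<le> f x \<and> f x \<le> 1"
    and eps: "\<And>A. A \<in> sets M \<Longrightarrow> \<bar>measure M A - measure M' A\<bar> \<le> e"
  shows "\<bar>(\<integral>x. f x \<partial>M) - (\<integral>x. f x \<partial>M')\<bar> \<le> e"
proof -
  interpret M: prob_space M by fact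
  interpret M': prob_space M' by fact
  note [measurable_cong] = sets and [measurable] = f
  \<comment> \<open>Discretising \<open>f\<close> costs at most \<open>1 / Suc n\<close> under each
    of the two measures.\<close>
  have bound: "\<bar>(\<integral>x. f x \<partial>M) - (\<integral>x. f x \<partial>M')\<bar> \<le> e + 2 / real (Suc n)" for n
  proof -
    define k where "k = Suc n"
    define A where "A j = {x \<in> space M. real j / real k \<le> f x}" for j
    define g where "g x = (\<Sum>j=1..k. indicator (A j) x / real k)" for x :: 'a
    have A: "A j \<in> sets M" for j unfolding A_def by measurable
    have sp: "space M' = space M" using sets by (rule sets_eq_imp_space_eq)
    have g: "g x \<le> f x \<and> f x \<le> g x + 1 / real k" if x: "x \<in> space M" for x
    proof -
      define q where "q = nat \<lfloor>f x * real k\<rfloor>"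
      have q: "real q \<le> f x * real k" "f x * real k < real q + 1"
        using f01[of x] unfolding q_def by (simp_all add: floor_less_iff)
      have "real q \<le> real k" using q(1) f01[of x] mult_right_mono[of "f x" 1 "real k"] by auto
      \<comment> \<open>Exactly the first \<open>q\<close> levels are reached at \<open>x\<close>,
        so \<open>g x\<close> is \<open>f x\<close> rounded down to a multiple of
        \<open>1 / k\<close>.\<close>
      then have "{j \<in> {1..k}. x \<in> A j} = {1..q}"
        using q x unfolding A_def k_def
        by (auto simp: field_simps)
      then have "(\<Sum>j=1..k. indicator (A j) x :: real) = real q"
        by (simp add: indicator_def sum.If_cases Int_def)
      then have "g x = real q / real k"
        unfolding g_def by (simp add: sum_divide_distrib[symmetric])
      moreover have "k > 0" by (simp add: k_def)
      ultimately show ?thesis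
        using q by (auto simp: pos_divide_le_eq add_divide_distrib[symmetric] pos_le_divide_eq)
    qed
    have int_g: "(\<integral>x. g x \<partial>M) = (\<Sum>j=1..k. measure M (A j) / real k)"
      "(\<integral>x. g x \<partial>M') = (\<Sum>j=1..k. measure M' (A j) / real k)"
    proof -
      have "integrable M (indicator (A j) :: 'a \<Rightarrow> real)" "integrable M' (indicator (A j) :: 'a \<Rightarrow> real)" for j
        using A[of j] sets by (simp_all add: integrable_indicator_iff M.emeasure_eq_measure M'.emeasure_eq_measure sp)
      then show "(\<integral>x. g x \<partial>M) = (\<Sum>j=1..k. measure M (A j) / real k)"
        "(\<integral>x. g x \<partial>M') = (\<Sum>j=1..k. measure M' (A j) / real k)"
        unfolding g_def using sets.sets_into_space[OF A] by (simp_all add: sp Int_absorb2)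
    qed
    have gm [measurable]: "g \<in> borel_measurable M" unfolding g_def using A by measurable
    have fi: "integrable M f" "integrable M' f"
      by (rule M.integral_bounds[where l=0 and u=1] M'.integral_bounds[where l=0 and u=1]; use f01 in auto)+
    have g01: "- 1 \<le> g x \<and> g x \<le> 1" if "x \<in> space M" for x
    proof -
      have "1 / real k \<le> 1" by (simp add: k_def)
      then show ?thesis using g[OF that] f01[of x] by linarith
    qed
    have gi: "integrable M g" "integrable M' g"
      by (rule M.integral_bounds[where l="-1" and u=1] M'.integral_bounds[where l="-1" and u=1]; use g01 sp in auto)+
    have "\<bar>(\<integral>x. g x \<partial>M) - (\<integral>x. g x \<partial>M')\<bar> = \<bar>\<Sum>j=1..k. (measure M (A j) - measure M' (A j)) / real k\<bar>"
      unfolding int_g by (simp add: sum_subtractf diff_divide_distrib)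
    also have "\<dots> \<le> (\<Sum>j=1..k. e / real k)"
      by (rule sum_abs[THEN order_trans], intro sum_mono) (use eps[OF A] in \<open>auto simp: divide_right_mono\<close>)
    also have "\<dots> = e" by (simp add: k_def)
    finally have 1: "\<bar>(\<integral>x. g x \<partial>M) - (\<integral>x. g x \<partial>M')\<bar> \<le> e" .
    have 2: "0 \<le> (\<integral>x. f x - g x \<partial>M)" "(\<integral>x. f x - g x \<partial>M) \<le> 1 / real k"
      by (rule M.integral_bounds(2)[where u="1 / real k"] M.integral_bounds(3)[where l=0],
          use g in \<open>auto simp: algebra_simps\<close>)+
    have 3: "0 \<le> (\<integral>x. f x - g x \<partial>M')" "(\<integral>x. f x - g x \<partial>M') \<le> 1 / real k"
      by (rule M'.integral_bounds(2)[where u="1 / real k"] M'.integral_bounds(3)[where l=0],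
          use g sp in \<open>auto simp: algebra_simps\<close>)+
    show ?thesis using 1 2 3 fi gi by (simp add: k_def)
  qed
  have "(\<lambda>n. e + 2 / real (Suc n)) \<longlonglongrightarrow> e + 0"
    by (intro tendsto_add tendsto_const LIMSEQ_Suc[OF lim_const_over_n])
  then show ?thesis using bound
    by (intro LIMSEQ_le_const[where X="\<lambda>n. e + 2 / real (Suc n)"]) auto
qed

text \<open>This is how the invariant measure will be produced. Finite additivity passes to setwise
  limits; countable additivity does so because the rate \<open>r\<close> is the same for all
  sets.\<close>

lemma setwise_uniform_limit_prob:
  fixes M :: "nat \<Rightarrow> 'a measure"
  assumes M: "\<And>n. prob_space (M n)" and sets: "\<And>n. sets (M n) = sets S"
    and r: "r \<longlonglongrightarrow> 0"
    and cauchy: "\<And>A m n. A \<in> sets S \<Longrightarrow> n \<le> m \<Longrightarrow> \<bar>measure (M m) A - measure (M n) A\<bar> \<le> r n"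
  obtains L where "prob_space L" "sets L = sets S"
    "\<And>A n. A \<in> sets S \<Longrightarrow> \<bar>measure L A - measure (M n) A\<bar> \<le> r n"
proof -
  interpret M: prob_space "M n" for n by (rule M)
  define f where "f A = lim (\<lambda>n. measure (M n) A)" for A
  have lim: "(\<lambda>n. measure (M n) A) \<longlonglongrightarrow> f A" if A: "A \<in> sets S" for A
  proof -
    have "Cauchy (\<lambda>n. measure (M n) A)"
    proof (rule metric_CauchyI)
      fix e :: real assume "e > 0"
      then obtain n0 where n0: "r n0 < e / 2"
        using order_tendstoD(2)[OF r, of "e/2"] by (auto simp: eventually_sequentially)
      show "\<exists>n0. \<forall>m\<ge>n0. \<forall>n\<ge>n0. dist (measure (M m) A) (measure (M n) A) < e"
      proof (intro exI allI impI)
        fix m n assume "n0 \<le> m" "n0 \<le> n"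
        then show "dist (measure (M m) A) (measure (M n) A) < e"
          using cauchy[OF A, of n0 m] cauchy[OF A, of n0 n] n0 by (simp add: dist_real_def)
      qed
    qed
    then show ?thesis unfolding f_def by (simp add: Cauchy_convergent_iff convergent_LIMSEQ_iff)
  qed
  have near: "\<bar>f A - measure (M n) A\<bar> \<le> r n" if A: "A \<in> sets S" for A n
  proof (rule LIMSEQ_le_const2)
    show "(\<lambda>m. \<bar>measure (M m) A - measure (M n) A\<bar>) \<longlonglongrightarrow> \<bar>f A - measure (M n) A\<bar>"
      by (intro tendsto_intros lim A)
    show "\<exists>n0. \<forall>m\<ge>n0. \<bar>measure (M m) A - measure (M n) A\<bar> \<le> r n"
      using cauchy[OF A] by blast
  qed
  have nonneg: "0 \<le> f A" if A: "A \<in> sets S" for A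
    by (rule LIMSEQ_le_const[OF lim[OF A]]) auto
  have pos: "positive (sets S) (\<lambda>A. ennreal (f A))"
    using lim[of "{}"] by (simp add: positive_def LIMSEQ_const_iff)
  have add: "additive (sets S) (\<lambda>A. ennreal (f A))"
  proof (unfold additive_def, intro ballI impI)
    fix A B assume A: "A \<in> sets S" and B: "B \<in> sets S" and d: "A \<inter> B = {}"
    have "(\<lambda>n. measure (M n) (A \<union> B)) \<longlonglongrightarrow> f A + f B"
      using tendsto_add[OF lim[OF A] lim[OF B]] A B d by (simp add: M.finite_measure_Union sets)
    with lim[of "A \<union> B"] A B have "f (A \<union> B) = f A + f B"
      using LIMSEQ_unique by blast
    then show "ennreal (f (A \<union> B)) = ennreal (f A) + ennreal (f B)"
      using nonneg A B by simp
  qed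
  have "countably_additive (sets S) (\<lambda>A. ennreal (f A))"
  proof (rule sets.empty_continuous_imp_countably_additive[OF pos add])
    fix A :: "nat \<Rightarrow> 'a set"
    assume A: "range A \<subseteq> sets S" and dec: "decseq A" and em: "(\<Inter>i. A i) = {}"
    have "(\<lambda>i. f (A i)) \<longlonglongrightarrow> 0"
    proof (rule LIMSEQ_I)
      fix e :: real assume "e > 0"
      \<comment> \<open>One index \<open>n\<close> serves all \<open>A i\<close> at once and uses up
        half of \<open>e\<close>; continuity from above of the single measure \<open>M n\<close>
        supplies the other half.\<close>
      then obtain n where n: "r n < e / 2"
        using order_tendstoD(2)[OF r, of "e/2"] by (auto simp: eventually_sequentially)
      have "(\<lambda>i. measure (M n) (A i)) \<longlonglongrightarrow> measure (M n) (\<Inter>i. A i)"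
        using A dec sets by (intro M.finite_Lim_measure_decseq) auto
      then have "eventually (\<lambda>i. measure (M n) (A i) < e / 2) sequentially"
        using \<open>e > 0\<close> em by (intro order_tendstoD(2)) auto
      then show "\<exists>i0. \<forall>i\<ge>i0. norm (f (A i) - 0) < e"
        unfolding eventually_sequentially
      proof (elim exE, intro exI allI impI)
        fix i0 i assume i0: "\<forall>i\<ge>i0. measure (M n) (A i) < e / 2" and "i0 \<le> i"
        moreover have "A i \<in> sets S" using A by auto
        ultimately show "norm (f (A i) - 0) < e"
          using near[of "A i" n] nonneg[of "A i"] n i0 by force
      qed
    qed
    then show "(\<lambda>i. ennreal (f (A i))) \<longlonglongrightarrow> 0"
      using tendsto_ennrealI by fastforce
  qed auto
  note em = emeasure_measure_of_sigma[OF sets.sigma_algebra_axioms pos this]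
  define L where "L = measure_of (space S) (sets S) (\<lambda>A. ennreal (f A))"
  have mL: "measure L A = f A" if "A \<in> sets S" for A
    using em[OF that] nonneg[OF that] unfolding L_def measure_def by simp
  have "measure (M n) (space S) = 1" for n
    using M.prob_space sets_eq_imp_space_eq[OF sets] by metis
  then have "f (space S) = 1"
    using LIMSEQ_unique[OF lim[of "space S"]] by auto
  show ?thesis
  proof (rule that[of L])
    show "prob_space L"
      using em[of "space S"] \<open>f (space S) = 1\<close> by (intro prob_spaceI) (simp add: L_def)
    show "sets L = sets S" by (simp add: L_def)
    show "\<bar>measure L A - measure (M n) A\<bar> \<le> r n" if "A \<in> sets S" for A n
      using near[OF that] mL[OF that] by simp
  qed
qed

section \<open>The torus, its probability measures and its function spaces\<close>

text \<open>The quotient map onto the torus, with values in the fundamental domain. It moves laws on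
  the plane to the unit square and turns Borel sets into periodic test functions.\<close>

definition fold_torus :: "real \<times> real \<Rightarrow> real \<times> real" where
  "fold_torus x = (frac (fst x), frac (snd x))"

lemma measurable_fold_torus [measurable]: "fold_torus \<in> borel \<rightarrow>\<^sub>M borel"
  unfolding fold_torus_def frac_def borel_prod[symmetric] by measurable

lemma fold_torus_in: "fold_torus x \<in> {0..<1} \<times> {0..<1}"
  by (simp add: fold_torus_def frac_lt_1)

lemma fold_torus_id: "x \<in> {0..<1} \<times> {0..<1} \<Longrightarrow> fold_torus x = x"
  by (cases x) (simp add: fold_torus_def frac_eq)

text \<open>Folding translates each coordinate by an integer.\<close>

lemma BY_fold_torus: "\<psi> \<in> BY \<Longrightarrow> \<psi> (fold_torus x) = \<psi> x"
proof -
  assume \<psi>: "\<psi> \<in> BY"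
  have 1: "\<psi> (a + of_int k, b) = \<psi> (a, b)" for a b k
    using \<psi> by (intro periodic_add_of_int[of "\<lambda>a. \<psi> (a, b)"]) (simp add: BY_def)
  have 2: "\<psi> (a, b + of_int k) = \<psi> (a, b)" for a b k
    using \<psi> by (intro periodic_add_of_int[of "\<lambda>b. \<psi> (a, b)"]) (simp add: BY_def)
  obtain a b where x: "x = (a, b)" by (cases x)
  show ?thesis
    unfolding x fold_torus_def using 1[of "frac a" "\<lfloor>a\<rfloor>" b] 2[of "frac a" "frac b" "\<lfloor>b\<rfloor>"]
    by (simp add: frac_def)
qed

text \<open>Invariance is tested against periodic functions only; this supplies enough of them to
  determine a measure.\<close>

lemma indicator_fold_torus_in_BY:
  assumes "A \<in> sets borel"
  shows "(\<lambda>x. indicator A (fold_torus x)) \<in> BY"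
proof -
  have "fold_torus (a + 1, b) = fold_torus (a, b)" "fold_torus (a, b + 1) = fold_torus (a, b)" for a b
    by (simp_all add: fold_torus_def frac_def)
  moreover have "bounded (range (\<lambda>x. indicator A (fold_torus x) :: real))"
    by (rule boundedI[of _ 1]) (auto simp: indicator_def)
  moreover have "(\<lambda>x. indicator A (fold_torus x) :: real) \<in> borel_measurable borel"
    using assms by measurable
  ultimately show ?thesis by (simp add: BY_def)
qed

lemma torus_prob_AE:
  assumes "torus_prob \<mu>"
  shows "AE x in \<mu>. x \<in> {0..<1} \<times> {0..<1}"
proof -
  interpret prob_space \<mu> using assms by (simp add: torus_prob_def)
  show ?thesis
    using assms prob_eq_1[of "{0..<1} \<times> {0..<1}"] by (simp add: torus_prob_def borel_Times)
qed

text \<open>Almost every point lies in the unit square, where folding is the identity.\<close>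

lemma torus_prob_measure:
  assumes "torus_prob \<mu>" "A \<in> sets borel"
  shows "measure \<mu> A = (\<integral>x. indicator A (fold_torus x) \<partial>\<mu>)"
proof -
  have s: "sets \<mu> = sets borel" using assms by (simp add: torus_prob_def)
  note [measurable_cong] = s and [measurable] = assms(2)
  have "(\<integral>x. indicator A (fold_torus x) \<partial>\<mu>) = (\<integral>x. indicat_real A x \<partial>\<mu>)"
    using torus_prob_AE[OF assms(1)] by (intro integral_cong_AE) (auto simp: fold_torus_id)
  then show ?thesis using s assms(2) sets_eq_imp_space_eq[OF s] by simp
qed

lemma BY_D:
  assumes "\<psi> \<in> BY"
  shows "\<psi> \<in> borel_measurable borel" "\<exists>B. \<forall>x. \<bar>\<psi> x\<bar> \<le> B"
    "\<psi> (p + 1, q) = \<psi> (p, q)" "\<psi> (p, q + 1) = \<psi> (p, q)"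
  using assms by (auto simp: BY_def bounded_iff)

lemma BY_affine: "\<psi> \<in> BY \<Longrightarrow> (\<lambda>x. c * \<psi> x + d) \<in> BY"
proof -
  assume \<psi>: "\<psi> \<in> BY"
  note [measurable] = BY_D(1)[OF \<psi>]
  obtain B where B: "\<And>x. \<bar>\<psi> x\<bar> \<le> B" using BY_D(2)[OF \<psi>] by blast
  have "bounded (range (\<lambda>x. c * \<psi> x + d))"
    by (rule boundedI[of _ "\<bar>c\<bar> * B + \<bar>d\<bar>"])
       (auto simp: abs_mult B intro!: order_trans[OF abs_triangle_ineq] mult_left_mono)
  then show ?thesis using \<psi> by (simp add: BY_def)
qed

lemma BTY_slice: "\<phi> \<in> BTY \<Longrightarrow> \<phi> s \<in> BY"
proof -
  assume \<phi>: "\<phi> \<in> BTY"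
  have "(\<lambda>x. (s, x)) \<in> borel \<rightarrow>\<^sub>M (borel :: (real \<times> real \<times> real) measure)"
    by (intro borel_measurable_continuous_onI continuous_intros)
  from measurable_compose[OF this, of "\<lambda>p. \<phi> (fst p) (snd p)"] \<phi>
  have "\<phi> s \<in> borel_measurable borel" by (simp add: BTY_def)
  moreover have "bounded (range (\<phi> s))"
  proof (rule bounded_subset[of "range (\<lambda>p. \<phi> (fst p) (snd p))"])
    show "range (\<phi> s) \<subseteq> range (\<lambda>p. \<phi> (fst p) (snd p))"
      by (intro image_subsetI image_eqI[of _ _ "(s, _)"]) simp_all
  qed (use \<phi> in \<open>simp add: BTY_def\<close>)
  ultimately show ?thesis using \<phi> by (simp add: BTY_def BY_def)
qed

lemma BTY_le_supnorm: "\<phi> \<in> BTY \<Longrightarrow> \<bar>\<phi> s x\<bar> \<le> supnorm \<phi>"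
proof -
  assume "\<phi> \<in> BTY"
  then obtain B where "\<forall>y\<in>range (\<lambda>p. \<phi> (fst p) (snd p)). norm y \<le> B"
    unfolding BTY_def bounded_iff by blast
  then have "bdd_above (range (\<lambda>p. \<bar>\<phi> (fst p) (snd p)\<bar>))" by (intro bdd_aboveI[of _ B]) force
  from cSUP_upper[OF _ this, of "(s, x)"] show ?thesis by (simp add: supnorm_def)
qed

section \<open>One step of the scheme and its transition operator\<close>

locale splitting_scheme =
  fixes v1 v2 :: "real \<Rightarrow> real \<Rightarrow> real" and \<sigma> :: real and N :: nat
  assumes sigma_pos: "\<sigma> > 0"
    and N_pos: "N > 0"
    and v1_meas [measurable]: "\<And>t. v1 t \<in> borel_measurable borel"
    and v2_meas [measurable]: "\<And>t. v2 t \<in> borel_measurable borel"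
    and v1_per: "\<And>t y. v1 (t + 1) y = v1 t y" "\<And>t y. v1 t (y + 1) = v1 t y"
    and v2_per: "\<And>t y. v2 (t + 1) y = v2 t y" "\<And>t y. v2 t (y + 1) = v2 t y"
begin

abbreviation stp where "stp \<equiv> step v1 v2 \<sigma> N"

definition amp where "amp = \<sigma> * sqrt (1 / real N)"

text \<open>The noiseless step from absolute time \<open>s\<close>: two shears in succession, with
  velocities taken at the midpoint of the time step.\<close>

definition mean where
  "mean s x = (let t = s + 1 / 2 / real N; y = fst x + v1 t (snd x) / real N in (y, snd x + v2 t y / real N))"

lemma amp_pos: "amp > 0"
  using sigma_pos N_pos by (simp add: amp_def)

text \<open>Under \<open>gauss2\<close> the new point is Gaussian with independent coordinates of
  standard deviation \<open>amp\<close>. State and time enter only through its centre, on which the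
  lower bound for the wrapped density does not depend.\<close>

lemma step_eq: "stp \<tau> n x \<xi> =
    (fst (mean (\<tau> + real n / real N) x) + amp * fst \<xi>, snd (mean (\<tau> + real n / real N) x) + amp * snd \<xi>)"
  by (simp add: step_def mean_def amp_def Let_def add_divide_distrib add.assoc)

lemma mean_per_time: "mean (s + 1) x = mean s x"
proof -
  have "s + 1 + 1 / 2 / real N = s + 1 / 2 / real N + 1" by simp
  then show ?thesis unfolding mean_def Let_def by (simp only: v1_per v2_per)
qed

text \<open>Periodicity of the velocities makes \<open>mean s\<close> commute with lattice
  translations, so that it descends to the torus.\<close>

lemma mean_per_space:
  "mean s (p + 1, q) = (fst (mean s (p, q)) + 1, snd (mean s (p, q)))"
  "mean s (p, q + 1) = (fst (mean s (p, q)), snd (mean s (p, q)) + 1)"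
proof -
  have *: "v2 t (p + 1 + d) = v2 t (p + d)" for t d
    using v2_per(2)[of t "p + d"] by (simp add: algebra_simps)
  show "mean s (p + 1, q) = (fst (mean s (p, q)) + 1, snd (mean s (p, q)))"
    by (simp add: mean_def Let_def *)
  show "mean s (p, q + 1) = (fst (mean s (p, q)), snd (mean s (p, q)) + 1)"
    by (simp add: mean_def Let_def v1_per)
qed

lemma measurable_mean [measurable]: "mean s \<in> borel \<rightarrow>\<^sub>M borel"
  unfolding mean_def Let_def borel_prod[symmetric] by measurable

lemma measurable_step [measurable]:
  "(\<lambda>p. stp \<tau> n (fst p) (snd p)) \<in> borel \<Otimes>\<^sub>M borel \<rightarrow>\<^sub>M borel"
  unfolding step_eq borel_prod[symmetric]
  using measurable_mean[unfolded borel_prod[symmetric]] by measurable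

text \<open>The step index is fixed at \<open>0\<close> because any other index can be absorbed into
  the time, see \<open>step_shift\<close>.\<close>

definition one_step where
  "one_step s \<psi> x = (\<integral>\<xi>. \<psi> (stp s 0 x \<xi>) \<partial>gauss2)"

lemma step_shift: "stp \<tau> n = stp (\<tau> + real n / real N) 0"
  by (intro ext) (simp add: step_eq)

lemma one_step_per: "one_step (s + 1) = one_step s"
  by (intro ext) (simp add: one_step_def step_eq mean_per_time)

lemma measurable_one_step_integrand:
  assumes [measurable]: "\<psi> \<in> borel_measurable borel"
  shows "(\<lambda>\<xi>. \<psi> (stp s n x \<xi>)) \<in> borel_measurable gauss2"
  by (rule measurable_compose[OF _ assms], rule measurable_compose[OF _ measurable_step, of "\<lambda>\<xi>. (x, \<xi>)", simplified])
     measurable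

lemma one_step_bounds:
  assumes "\<psi> \<in> BY" "\<And>x. l \<le> \<psi> x" "\<And>x. \<psi> x \<le> u"
  shows "integrable gauss2 (\<lambda>\<xi>. \<psi> (stp s n x \<xi>))" "l \<le> one_step s \<psi> x" "one_step s \<psi> x \<le> u"
proof -
  interpret prob_space gauss2 by (rule prob_space_gauss2)
  note m = measurable_one_step_integrand[OF BY_D(1)[OF assms(1)]]
  show "integrable gauss2 (\<lambda>\<xi>. \<psi> (stp s n x \<xi>))" "l \<le> one_step s \<psi> x" "one_step s \<psi> x \<le> u"
    unfolding one_step_def by (rule integral_bounds[OF m assms(2,3)])+
qed

text \<open>A lattice translation of the state only translates the centre of the Gaussian, which a
  periodic \<open>\<psi>\<close> does not notice.\<close>

lemma one_step_in_BY:
  assumes \<psi>: "\<psi> \<in> BY"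
  shows "one_step s \<psi> \<in> BY"
proof -
  interpret prob_space gauss2 by (rule prob_space_gauss2)
  note [measurable] = BY_D(1)[OF \<psi>]
  have "(\<lambda>p. \<psi> (stp s 0 (fst p) (snd p))) \<in> borel_measurable (borel \<Otimes>\<^sub>M gauss2)"
    by measurable
  then have 1: "one_step s \<psi> \<in> borel_measurable borel"
    unfolding one_step_def by (intro borel_measurable_lebesgue_integral) (simp add: case_prod_beta')
  obtain B where B: "\<And>x. \<bar>\<psi> x\<bar> \<le> B" using BY_D(2)[OF \<psi>] by blast
  have "- B \<le> one_step s \<psi> x" "one_step s \<psi> x \<le> B" for x
    using B by (auto intro!: one_step_bounds \<psi> simp: abs_le_iff minus_le_iff)
  then have 2: "bounded (range (one_step s \<psi>))"
    by (intro boundedI[of _ B]) (auto simp: abs_le_iff minus_le_iff)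
  have 3: "\<psi> (p + 1 + b, q) = \<psi> (p + b, q)" "\<psi> (p, q + 1 + b) = \<psi> (p, q + b)" for p q b
    using BY_D(3)[OF \<psi>, of "p + b" q] BY_D(4)[OF \<psi>, of p "q + b"] by (simp_all add: algebra_simps)
  show ?thesis
    using 1 2 unfolding BY_def by (simp add: one_step_def step_eq mean_per_space 3)
qed

text \<open>Doeblin's constant: each coordinate contributes the density of its noise at distance
  \<open>1\<close> from the centre.\<close>

definition \<delta> where "\<delta> = (std_normal_density (1 / amp) / amp)\<^sup>2"

lemma delta_pos: "\<delta> > 0"
  using amp_pos normal_density_pos[of 1 0 "1 / amp"] by (simp add: \<delta>_def)

text \<open>Boundedness makes both integrals finite, so the estimate for nonnegative integrals
  carries over to real ones.\<close>

lemma one_step_ge: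
  assumes \<psi>: "\<psi> \<in> BY" and nonneg: "\<And>x. 0 \<le> \<psi> x"
  shows "\<delta> * (\<integral>y. \<psi> y \<partial>unif2) \<le> one_step s \<psi> x"
proof -
  interpret U: prob_space unif2 by (rule prob_space_unif2)
  obtain B where B: "\<And>x. \<bar>\<psi> x\<bar> \<le> B" using BY_D(2)[OF \<psi>] by blast
  note m [measurable] = BY_D(1)[OF \<psi>]
  have i: "integrable unif2 \<psi>" "0 \<le> integral\<^sup>L unif2 \<psi>"
    using B nonneg by (auto intro!: U.integral_bounds[where l=0 and u=B] simp: abs_le_iff)
  have j: "integrable gauss2 (\<lambda>\<xi>. \<psi> (stp s 0 x \<xi>))" "0 \<le> one_step s \<psi> x"
    using B nonneg by (auto intro!: one_step_bounds[where l=0 and u=B] \<psi> simp: abs_le_iff)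
  have "ennreal (\<delta> * (\<integral>y. \<psi> y \<partial>unif2)) = ennreal \<delta> * (\<integral>\<^sup>+y. ennreal (\<psi> y) \<partial>unif2)"
    using i nonneg delta_pos by (simp add: nn_integral_eq_integral ennreal_mult)
  also have "\<dots> \<le> (\<integral>\<^sup>+z. ennreal (\<psi> (fst (mean s x) + amp * fst z, snd (mean s x) + amp * snd z)) \<partial>gauss2)"
    unfolding \<delta>_def
    by (rule nn_integral_gauss2_ge) (auto simp: BY_D[OF \<psi>] amp_pos)
  also have "\<dots> = ennreal (one_step s \<psi> x)"
    unfolding one_step_def using j nonneg by (simp add: nn_integral_eq_integral step_eq)
  finally show ?thesis using j by simp
qed

lemma one_step_affine: "\<psi> \<in> BY \<Longrightarrow> one_step s (\<lambda>x. c * \<psi> x + d) x = c * one_step s \<psi> x + d"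
proof -
  assume \<psi>: "\<psi> \<in> BY"
  interpret prob_space gauss2 by (rule prob_space_gauss2)
  obtain B where B: "\<And>x. \<bar>\<psi> x\<bar> \<le> B" using BY_D(2)[OF \<psi>] by blast
  have "integrable gauss2 (\<lambda>\<xi>. \<psi> (stp s 0 x \<xi>))"
    by (rule one_step_bounds[where l="-B" and u=B, OF \<psi>]) (use B in \<open>auto simp: abs_le_iff minus_le_iff\<close>)
  then show ?thesis using prob_space by (simp add: one_step_def)
qed

lemma one_step_contracts:
  assumes \<psi>: "\<psi> \<in> BY" and l: "\<And>x. \<psi> x \<in> {l..l + d}"
  shows "\<exists>l'. \<forall>x. one_step s \<psi> x \<in> {l'..l' + exp (- \<delta>) * d}"
proof -
  interpret U: prob_space unif2 by (rule prob_space_unif2)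
  note [measurable] = BY_D(1)[OF \<psi>]
  have d: "0 \<le> d" using l[of 0] by simp
  have i: "integrable unif2 \<psi>"
    by (rule U.integral_bounds[where l=l and u="l+d"]) (use l in auto)
  define b where "b = integral\<^sup>L unif2 \<psi>"
  \<comment> \<open>Applied to the nonnegative functions \<open>\<psi> - l\<close> and
    \<open>l + d - \<psi>\<close>, Doeblin's bound raises the lower end by
    \<open>\<delta> * (b - l)\<close> and lowers the upper end by
    \<open>\<delta> * (l + d - b)\<close>. Together these remove
    \<open>\<delta> * d\<close>.\<close>
  have 1: "\<delta> * (b - l) \<le> one_step s \<psi> x - l" for x
    using one_step_ge[OF BY_affine[OF \<psi>, of 1 "-l"], of s x] one_step_affine[OF \<psi>, of s 1 "-l" x] l i U.prob_space
    by (simp add: b_def)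
  have 2: "\<delta> * (l + d - b) \<le> l + d - one_step s \<psi> x" for x
    using one_step_ge[OF BY_affine[OF \<psi>, of "-1" "l + d"], of s x] one_step_affine[OF \<psi>, of s "-1" "l + d" x] l i U.prob_space
    by (simp add: b_def)
  \<comment> \<open>In exponential form the factors of successive steps multiply to
    \<open>exp (- \<delta> * real i)\<close>.\<close>
  have "1 - \<delta> \<le> exp (- \<delta>)" using exp_ge_add_one_self[of "- \<delta>"] by simp
  then have "(1 - \<delta>) * d \<le> exp (- \<delta>) * d" using d by (rule mult_right_mono)
  then show ?thesis using 1 2
    by (intro exI[of _ "l + \<delta> * (b - l)"] allI) (simp add: algebra_simps, smt (verit))
qed

section \<open>Evolution over many steps\<close>

text \<open>The backward evolution of observables from time \<open>\<tau>\<close>: the operator of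
  the last step acts on \<open>\<psi>\<close> first.\<close>

primrec evolve :: "real \<Rightarrow> nat \<Rightarrow> (real \<times> real \<Rightarrow> real) \<Rightarrow> real \<times> real \<Rightarrow> real" where
  "evolve \<tau> 0 \<psi> = \<psi>"
| "evolve \<tau> (Suc i) \<psi> = evolve \<tau> i (one_step (\<tau> + real i / real N) \<psi>)"

lemma evolve_in_BY: "\<psi> \<in> BY \<Longrightarrow> evolve \<tau> i \<psi> \<in> BY"
  by (induction i arbitrary: \<psi>) (simp_all add: one_step_in_BY)

lemma evolve_bounds:
  assumes "\<psi> \<in> BY" "\<And>x. l \<le> \<psi> x" "\<And>x. \<psi> x \<le> u"
  shows "l \<le> evolve \<tau> i \<psi> x \<and> evolve \<tau> i \<psi> x \<le> u"
  using assms
proof (induction i arbitrary: \<psi>)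
  case (Suc i)
  from Suc.IH[OF one_step_in_BY[OF Suc.prems(1)] one_step_bounds(2,3)[OF Suc.prems]] show ?case by simp
qed auto

lemma evolve_contracts:
  assumes "\<psi> \<in> BY" and "\<And>x. \<psi> x \<in> {l..l + d}"
  shows "\<exists>l'. \<forall>x. evolve \<tau> i \<psi> x \<in> {l'..l' + exp (- \<delta> * real i) * d}"
  using assms
proof (induction i arbitrary: \<psi> l d)
  case 0
  then show ?case by auto
next
  case (Suc i)
  from one_step_contracts[OF Suc.prems] obtain l' where
    "\<And>x. one_step (\<tau> + real i / real N) \<psi> x \<in> {l'..l' + exp (- \<delta>) * d}" by blast
  from Suc.IH[OF one_step_in_BY[OF Suc.prems(1)] this] show ?case
    by (simp add: exp_add[symmetric] mult.assoc[symmetric] algebra_simps)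
qed

text \<open>The Chapman-Kolmogorov equation. The induction is on the later block of steps, the end
  at which \<open>evolve\<close> recurses.\<close>

lemma evolve_add: "evolve \<tau> (j + i) \<psi> = evolve \<tau> j (evolve (\<tau> + real j / real N) i \<psi>)"
  by (induction i arbitrary: \<psi>) (simp_all add: add_divide_distrib add.assoc)

lemma evolve_per: "evolve (\<tau> + 1) i \<psi> = evolve \<tau> i \<psi>"
proof (induction i arbitrary: \<psi>)
  case (Suc i)
  have "\<tau> + 1 + real i / real N = \<tau> + real i / real N + 1" by simp
  then show ?case by (simp only: evolve.simps Suc one_step_per)
qed simp

text \<open>After \<open>N * n\<close> steps the time has advanced by the integer \<open>n\<close>,
  so by periodicity the later block may start at \<open>\<tau>\<close> again.\<close>

lemma evolve_add_period: "evolve \<tau> (N * n + i) \<psi> = evolve \<tau> (N * n) (evolve \<tau> i \<psi>)"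
proof -
  have "evolve (\<tau> + real n) i \<psi> = evolve \<tau> i \<psi>" for n :: nat
  proof (induction n)
    case (Suc n)
    then show ?case using evolve_per[of "\<tau> + real n" i \<psi>] by (simp add: algebra_simps)
  qed simp
  then show ?thesis using N_pos by (simp add: evolve_add)
qed

text \<open>Each application of the space-time operator also moves the time argument of
  \<open>\<phi>\<close> forward by \<open>1 / real N\<close>.\<close>

lemma Idt_funpow: "(Idt v1 v2 \<sigma> N ^^ k) \<phi> \<tau> = evolve \<tau> k (\<phi> (\<tau> + real k / real N))"
proof (induction k arbitrary: \<phi>)
  case (Suc k)
  have "Idt v1 v2 \<sigma> N \<phi> (\<tau> + real k / real N)
      = one_step (\<tau> + real k / real N) (\<phi> (\<tau> + real k / real N + 1 / real N))"
    by (intro ext) (simp add: Idt_def one_step_def)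
  then show ?case
    by (simp add: funpow_Suc_right Suc del: funpow.simps) (simp add: add_divide_distrib algebra_simps)
qed simp

section \<open>Expectations along the chain\<close>

lemma chain_cong:
  "(\<And>j. j < i \<Longrightarrow> \<xi> j = \<xi>' j) \<Longrightarrow> chain v1 v2 \<sigma> N \<tau> x \<xi> i = chain v1 v2 \<sigma> N \<tau> x \<xi>' i"
  by (induction i) auto

text \<open>The noise space is held fixed while \<open>i\<close> grows, since the induction needs
  all earlier states on one space.\<close>

lemma measurable_chain:
  "i \<le> k \<Longrightarrow> (\<lambda>\<xi>. chain v1 v2 \<sigma> N \<tau> x \<xi> i) \<in> noise k \<rightarrow>\<^sub>M borel"
proof (induction i)
  case 0
  then show ?case by simp
next
  case (Suc i)
  have [measurable]: "(\<lambda>\<xi>. chain v1 v2 \<sigma> N \<tau> x \<xi> i) \<in> noise k \<rightarrow>\<^sub>M borel"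
    using Suc by simp
  have [measurable]: "(\<lambda>\<xi>. \<xi> i) \<in> noise k \<rightarrow>\<^sub>M borel"
    unfolding noise_def using Suc.prems
    by (subst measurable_cong_sets[OF refl sets_gauss2[symmetric]]) (auto intro: measurable_component_singleton)
  show ?case
    using measurable_compose[OF _ measurable_step[of \<tau> i], of "\<lambda>\<xi>. (chain v1 v2 \<sigma> N \<tau> x \<xi> i, \<xi> i)" "noise k"]
    by simp
qed

lemma prob_space_noise: "prob_space (noise i)"
  unfolding noise_def by (intro prob_space_PiM prob_space_gauss2)

text \<open>The Markov property: integrating out the last noise variable first leaves
  \<open>one_step\<close> evaluated at the preceding state.\<close>

lemma chain_exp_eq_evolve:
  "\<psi> \<in> BY \<Longrightarrow> chain_exp v1 v2 \<sigma> N \<tau> x i \<psi> = evolve \<tau> i \<psi> x"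
proof (induction i arbitrary: \<psi>)
  case 0
  interpret prob_space "noise 0" by (rule prob_space_noise)
  show ?case by (simp add: chain_exp_def prob_space)
next
  case (Suc i)
  let ?c = "chain v1 v2 \<sigma> N \<tau> x"
  interpret gauss2: prob_space gauss2 by (rule prob_space_gauss2)
  interpret product_sigma_finite "\<lambda>_. gauss2" ..
  interpret noise: prob_space "noise (Suc i)" by (rule prob_space_noise)
  obtain B where B: "\<And>x. \<bar>\<psi> x\<bar> \<le> B" using BY_D(2)[OF Suc.prems] by blast
  have "integrable (noise (Suc i)) (\<lambda>\<xi>. \<psi> (?c \<xi> (Suc i)))"
    by (rule noise.integral_bounds[where l="-B" and u=B])
       (use B measurable_compose[OF measurable_chain BY_D(1)[OF Suc.prems]] in \<open>auto simp: abs_le_iff minus_le_iff simp del: chain.simps\<close>)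
  then have "chain_exp v1 v2 \<sigma> N \<tau> x (Suc i) \<psi>
      = (\<integral>\<xi>. (\<integral>z. \<psi> (?c (\<xi>(i := z)) (Suc i)) \<partial>gauss2) \<partial>noise i)"
    unfolding chain_exp_def noise_def lessThan_Suc by (intro product_integral_insert) auto
  also have "\<dots> = (\<integral>\<xi>. one_step (\<tau> + real i / real N) \<psi> (?c \<xi> i) \<partial>noise i)"
  proof -
    \<comment> \<open>The state after \<open>i\<close> steps depends only on the noise with indices
      below \<open>i\<close>.\<close>
    have "?c (\<xi>(i := z)) i = ?c \<xi> i" for \<xi> z by (rule chain_cong) auto
    then show ?thesis by (simp add: one_step_def step_shift[of \<tau> i])
  qed
  finally show ?case using Suc.IH[OF one_step_in_BY[OF Suc.prems]] by (simp add: chain_exp_def)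
qed

lemma Iper_eq_evolve: "\<psi> \<in> BY \<Longrightarrow> Iper v1 v2 \<sigma> N \<tau> \<psi> x = evolve \<tau> N \<psi> x"
  by (simp add: Iper_def chain_exp_eq_evolve)

section \<open>The invariant measure: convergence, existence, uniqueness\<close>

text \<open>By invariance the integral of \<open>\<psi>\<close> is also that of the evolved
  function, so it lies in the same short interval as all values of that function. The interval
  starts with length \<open>2 * B\<close>.\<close>

lemma evolve_minus_integral_le:
  assumes \<mu>: "torus_prob \<mu>" "invariant v1 v2 \<sigma> N \<tau> \<mu>"
    and \<psi>: "\<psi> \<in> BY" and B: "\<And>x. \<bar>\<psi> x\<bar> \<le> B"
  shows "\<bar>evolve \<tau> (N * n) \<psi> x - (\<integral>y. \<psi> y \<partial>\<mu>)\<bar> \<le> 2 * B * exp (- \<delta> * real (N * n))"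
proof -
  interpret prob_space \<mu> using \<mu> by (simp add: torus_prob_def)
  have s: "sets \<mu> = sets borel" using \<mu> by (simp add: torus_prob_def)
  have inv: "(\<integral>y. evolve \<tau> (N * n) \<psi> y \<partial>\<mu>) = (\<integral>y. \<psi> y \<partial>\<mu>)"
  proof (induction n)
    case (Suc n)
    \<comment> \<open>The first period is split off, because the hypothesis on \<open>\<mu>\<close>
      concerns one period applied outermost.\<close>
    have "evolve \<tau> (N * Suc n) \<psi> = evolve \<tau> N (evolve \<tau> (N * n) \<psi>)"
      using evolve_add_period[of \<tau> 1 "N * n" \<psi>] by simp
    then have "(\<integral>y. evolve \<tau> (N * Suc n) \<psi> y \<partial>\<mu>) = (\<integral>y. Iper v1 v2 \<sigma> N \<tau> (evolve \<tau> (N * n) \<psi>) y \<partial>\<mu>)"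
      by (simp add: Iper_eq_evolve evolve_in_BY \<psi>)
    then show ?case using \<mu>(2) evolve_in_BY[OF \<psi>] Suc by (simp add: invariant_def)
  qed simp
  have "\<exists>l'. \<forall>x. evolve \<tau> (N * n) \<psi> x \<in> {l'..l' + exp (- \<delta> * real (N * n)) * (2 * B)}"
    using B by (intro evolve_contracts[OF \<psi>, of "-B"]) (auto simp: abs_le_iff minus_le_iff)
  then obtain l where l: "\<And>x. l \<le> evolve \<tau> (N * n) \<psi> x"
      "\<And>x. evolve \<tau> (N * n) \<psi> x \<le> l + exp (- \<delta> * real (N * n)) * (2 * B)" by auto
  have "evolve \<tau> (N * n) \<psi> \<in> borel_measurable \<mu>"
    using BY_D(1)[OF evolve_in_BY[OF \<psi>]] s by (simp cong: measurable_cong_sets)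
  from integral_bounds(2,3)[OF this l] l[of x] show ?thesis
    unfolding inv by (simp add: abs_le_iff mult.commute)
qed

lemma exp_delta_tendsto: "(\<lambda>n. c * exp (- \<delta> * real (N * n))) \<longlonglongrightarrow> 0"
proof -
  have "exp (- \<delta> * real (N * n)) = exp (- \<delta> * real N) ^ n" for n
    by (simp add: exp_of_nat_mult[symmetric] mult.assoc mult.commute mult.left_commute)
  moreover have "(\<lambda>n. c * exp (- \<delta> * real N) ^ n) \<longlonglongrightarrow> c * 0"
    using delta_pos N_pos by (intro tendsto_mult tendsto_const LIMSEQ_power_zero) simp
  ultimately show ?thesis by simp
qed

text \<open>The folded laws of the chain from the origin after whole periods are uniformly Cauchy
  over Borel sets. Their limit is invariant because one more period does not change it.\<close>

lemma invariant_ex: "\<exists>\<mu>. torus_prob \<mu> \<and> invariant v1 v2 \<sigma> N \<tau> \<mu>"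
proof -
  define M where
    "M n = distr (noise (N * n)) borel (\<lambda>\<xi>. fold_torus (chain v1 v2 \<sigma> N \<tau> 0 \<xi> (N * n)))" for n
  \<comment> \<open>The factor \<open>1\<close> is the length of an interval containing the values
    of an indicator.\<close>
  define r where "r n = 1 * exp (- \<delta> * real (N * n))" for n
  have [measurable]: "(\<lambda>\<xi>. chain v1 v2 \<sigma> N \<tau> x \<xi> k) \<in> noise k \<rightarrow>\<^sub>M borel" for x k
    by (rule measurable_chain) simp
  have M: "prob_space (M n)" "sets (M n) = sets borel" for n
    unfolding M_def by (auto intro!: prob_space.prob_space_distr prob_space_noise)
  have intM: "(\<integral>x. \<psi> x \<partial>M n) = evolve \<tau> (N * n) \<psi> 0" if "\<psi> \<in> BY" for \<psi> n
    using that BY_D(1)[OF that] unfolding M_def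
    by (subst integral_distr) (auto simp: BY_fold_torus chain_exp_eq_evolve[symmetric] chain_exp_def)
  have "AE x in M n. x \<in> {0..<1} \<times> {0..<1}" for n
    unfolding M_def by (subst AE_distr_iff) (auto simp: fold_torus_in borel_Times)
  then have M1: "measure (M n) ({0..<1} \<times> {0..<1}) = 1" for n
    using M prob_space.prob_eq_1[OF M(1), of "{0..<1} \<times> {0..<1}"] by (auto simp: borel_Times)
  have torus: "torus_prob (M n)" for n using M M1 by (simp add: torus_prob_def)
  have cauchy: "\<bar>measure (M m) A - measure (M n) A\<bar> \<le> r n" if A: "A \<in> sets borel" and "n \<le> m" for A m n
  proof -
    let ?\<psi> = "\<lambda>x. indicator A (fold_torus x) :: real"
    have \<psi>: "?\<psi> \<in> BY" by (rule indicator_fold_torus_in_BY[OF A])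
    have m: "m = (m - n) + n" using \<open>n \<le> m\<close> by simp
    \<comment> \<open>The last \<open>n\<close> periods confine the values to an interval of length
      \<open>r n\<close>; the preceding \<open>m - n\<close> periods merely average within
      it.\<close>
    have eq: "evolve \<tau> (N * m) ?\<psi> = evolve \<tau> (N * (m - n)) (evolve \<tau> (N * n) ?\<psi>)"
      by (subst m) (simp only: distrib_left evolve_add_period)
    have "\<exists>l'. \<forall>x. evolve \<tau> (N * n) ?\<psi> x \<in> {l'..l' + exp (- \<delta> * real (N * n)) * 1}"
      by (intro evolve_contracts[OF \<psi>, of 0]) (auto simp: indicator_def)
    then obtain l where l: "\<And>x. l \<le> evolve \<tau> (N * n) ?\<psi> x"
      "\<And>x. evolve \<tau> (N * n) ?\<psi> x \<le> l + r n" by (auto simp: r_def)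
    have "\<bar>evolve \<tau> (N * m) ?\<psi> 0 - evolve \<tau> (N * n) ?\<psi> 0\<bar> \<le> r n"
      using evolve_bounds[OF evolve_in_BY[OF \<psi>] l, of \<tau> "N * (m - n)" 0] l[of 0] unfolding eq by linarith
    then show ?thesis
      by (simp add: torus_prob_measure[OF torus A] intM[OF \<psi>])
  qed
  have r: "r \<longlonglongrightarrow> 0" unfolding r_def by (rule exp_delta_tendsto)
  from setwise_uniform_limit_prob[OF M r cauchy] obtain L where L: "prob_space L" "sets L = sets borel"
    "\<And>A n. A \<in> sets borel \<Longrightarrow> \<bar>measure L A - measure (M n) A\<bar> \<le> r n" by blast
  have mL: "(\<lambda>n. measure (M n) A) \<longlonglongrightarrow> measure L A" if "A \<in> sets borel" for A
    by (rule LIM_zero_cancel, rule Lim_null_comparison[OF _ r])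
       (use L(3)[OF that] in \<open>auto simp: abs_minus_commute\<close>)
  have "measure L ({0..<1} \<times> {0..<1}) = 1"
    using mL[of "{0..<1} \<times> {0..<1}"] by (simp add: M1 borel_Times LIMSEQ_const_iff)
  with L have tL: "torus_prob L" by (simp add: torus_prob_def)
  have intL: "(\<lambda>n. evolve \<tau> (N * n) \<psi> 0) \<longlonglongrightarrow> (\<integral>x. \<psi> x \<partial>L)" if \<psi>: "\<psi> \<in> BY" for \<psi>
  proof -
    interpret L: prob_space L by (rule L)
    obtain B where B: "\<And>x. \<bar>\<psi> x\<bar> \<le> B" using BY_D(2)[OF \<psi>] by blast
    \<comment> \<open>A strictly positive bound, so that \<open>\<psi>\<close> can be rescaled from
      \<open>[-C, C]\<close> to \<open>[0, 1]\<close>, the range required by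
      \<open>prob_distance_integral\<close>. Undoing the scaling costs the factor
      \<open>2 * C\<close>.\<close>
    define C where "C = \<bar>B\<bar> + 1"
    have C: "C > 0" "\<bar>\<psi> x\<bar> \<le> C" for x using B[of x] by (auto simp: C_def)
    let ?f = "\<lambda>x. 1 / (2 * C) * \<psi> x + 1 / 2"
    have f: "?f \<in> BY" by (rule BY_affine[OF \<psi>])
    have f01: "0 \<le> ?f x \<and> ?f x \<le> 1" for x
      using C(1) C(2)[of x] by (auto simp: field_simps abs_le_iff)
    have i: "integrable L \<psi>"
      by (rule L.integral_bounds[where l="-C" and u=C])
         (use C BY_D(1)[OF \<psi>] L(2) in \<open>auto simp: abs_le_iff minus_le_iff cong: measurable_cong_sets\<close>)
    have iM: "integrable (M n) \<psi>" for n
      by (rule prob_space.integral_bounds[OF M(1), where l="-C" and u=C])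
         (use C BY_D(1)[OF \<psi>] M(2) in \<open>auto simp: abs_le_iff minus_le_iff cong: measurable_cong_sets\<close>)
    have near: "\<bar>(\<integral>x. ?f x \<partial>M n) - (\<integral>x. ?f x \<partial>L)\<bar> \<le> r n" for n
      by (rule prob_distance_integral[OF M(1) L(1)])
         (use M L f01 BY_D(1)[OF f] in \<open>auto simp: abs_minus_commute cong: measurable_cong_sets\<close>)
    have affine: "(\<integral>x. ?f x \<partial>K) = 1 / (2 * C) * (\<integral>x. \<psi> x \<partial>K) + 1 / 2"
      if "prob_space K" "integrable K \<psi>" for K
    proof -
      interpret K: prob_space K by fact
      show ?thesis using that by (simp add: K.prob_space)
    qed
    have scaled: "\<bar>1 / (2 * C) * (evolve \<tau> (N * n) \<psi> 0 - (\<integral>x. \<psi> x \<partial>L))\<bar> \<le> r n" for n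
      using near[of n] unfolding affine[OF M(1) iM] affine[OF L(1) i] intM[OF \<psi>]
      by (simp add: right_diff_distrib)
    have "\<bar>evolve \<tau> (N * n) \<psi> 0 - (\<integral>x. \<psi> x \<partial>L)\<bar> \<le> 2 * C * r n" for n
      using C(1) scaled[of n] by (simp add: abs_mult field_simps)
    then have "(\<lambda>n. evolve \<tau> (N * n) \<psi> 0 - (\<integral>x. \<psi> x \<partial>L)) \<longlonglongrightarrow> 0"
      by (intro Lim_null_comparison[OF always_eventually exp_delta_tendsto[of "2 * C"]]) (simp add: r_def)
    then show ?thesis by (rule LIM_zero_cancel)
  qed
  have "invariant v1 v2 \<sigma> N \<tau> L"
    unfolding invariant_def
  proof
    fix \<psi> assume \<psi>: "\<psi> \<in> BY"
    \<comment> \<open>The values after \<open>Suc n\<close> periods have two descriptions: as a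
      shifted sequence for \<open>\<psi>\<close>, and as the sequence for \<open>\<psi>\<close>
      evolved by one period. Their limits must agree.\<close>
    have "(\<lambda>n. evolve \<tau> (N * n) (evolve \<tau> N \<psi>) 0) \<longlonglongrightarrow> (\<integral>x. evolve \<tau> N \<psi> x \<partial>L)"
      by (rule intL[OF evolve_in_BY[OF \<psi>]])
    moreover have "evolve \<tau> (N * n) (evolve \<tau> N \<psi>) = evolve \<tau> (N * Suc n) \<psi>" for n
      using evolve_add_period[of \<tau> n N \<psi>] by (simp add: add.commute)
    ultimately have "(\<lambda>n. evolve \<tau> (N * Suc n) \<psi> 0) \<longlonglongrightarrow> (\<integral>x. evolve \<tau> N \<psi> x \<partial>L)" by simp
    with LIMSEQ_Suc[OF intL[OF \<psi>]] have "(\<integral>x. evolve \<tau> N \<psi> x \<partial>L) = (\<integral>x. \<psi> x \<partial>L)"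
      by (intro LIMSEQ_unique)
    then show "(\<integral>x. Iper v1 v2 \<sigma> N \<tau> \<psi> x \<partial>L) = (\<integral>x. \<psi> x \<partial>L)"
      by (simp add: Iper_eq_evolve[OF \<psi>])
  qed
  with tL show ?thesis by blast
qed

text \<open>Under any invariant measure, the integral of a periodic test function is the limit of
  its evolution at the origin, which does not mention the measure.\<close>

lemma invariant_unique:
  assumes "torus_prob \<mu>" "invariant v1 v2 \<sigma> N \<tau> \<mu>" "torus_prob \<nu>" "invariant v1 v2 \<sigma> N \<tau> \<nu>"
  shows "\<mu> = \<nu>"
proof -
  have lim: "(\<lambda>n. evolve \<tau> (N * n) \<psi> 0) \<longlonglongrightarrow> (\<integral>y. \<psi> y \<partial>\<mu>)"
    if \<mu>: "torus_prob \<mu>" "invariant v1 v2 \<sigma> N \<tau> \<mu>" and \<psi>: "\<psi> \<in> BY" for \<mu> \<psi>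
  proof -
    obtain B where B: "\<And>x. \<bar>\<psi> x\<bar> \<le> B" using BY_D(2)[OF \<psi>] by blast
    show ?thesis
      by (rule LIM_zero_cancel, rule Lim_null_comparison[OF _ exp_delta_tendsto[of "2 * B"]])
         (use evolve_minus_integral_le[OF \<mu> \<psi> B] in auto)
  qed
  interpret \<mu>: prob_space \<mu> using assms by (simp add: torus_prob_def)
  interpret \<nu>: prob_space \<nu> using assms by (simp add: torus_prob_def)
  show ?thesis
  proof (rule measure_eqI)
    show "sets \<mu> = sets \<nu>" using assms by (simp add: torus_prob_def)
    fix A assume "A \<in> sets \<mu>"
    then have A: "A \<in> sets borel" using assms by (simp add: torus_prob_def)
    note \<psi> = indicator_fold_torus_in_BY[OF A]
    have "measure \<mu> A = measure \<nu> A"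
      unfolding torus_prob_measure[OF assms(1) A] torus_prob_measure[OF assms(3) A]
      by (rule LIMSEQ_unique[OF lim[OF assms(1,2) \<psi>] lim[OF assms(3,4) \<psi>]])
    then show "emeasure \<mu> A = emeasure \<nu> A"
      by (simp add: \<mu>.emeasure_eq_measure \<nu>.emeasure_eq_measure)
  qed
qed

text \<open>Existence and uniqueness make the definite description in \<open>pi_inv\<close>
  meaningful.\<close>

lemma pi_inv: "torus_prob (pi_inv v1 v2 \<sigma> N \<tau>)" "invariant v1 v2 \<sigma> N \<tau> (pi_inv v1 v2 \<sigma> N \<tau>)"
proof -
  have "\<exists>!\<mu>. torus_prob \<mu> \<and> invariant v1 v2 \<sigma> N \<tau> \<mu>"
    using invariant_ex invariant_unique by blast
  from theI'[OF this]
  show "torus_prob (pi_inv v1 v2 \<sigma> N \<tau>)" "invariant v1 v2 \<sigma> N \<tau> (pi_inv v1 v2 \<sigma> N \<tau>)"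
    by (simp_all add: pi_inv_def)
qed

section \<open>Geometric ergodicity, centred series and the kernel\<close>

lemma BTY_per_nat: "\<phi> \<in> BTY \<Longrightarrow> \<phi> (\<tau> + real n) = \<phi> \<tau>"
  using periodic_add_of_int[of \<phi> \<tau> "int n"] by (auto simp: BTY_def fun_eq_iff)

lemma Idt_period_funpow:
  assumes "\<phi> \<in> BTY"
  shows "((Idt v1 v2 \<sigma> N ^^ N) ^^ n) \<phi> \<tau> = evolve \<tau> (N * n) (\<phi> \<tau>)"
  using N_pos BTY_per_nat[OF assms, of \<tau> n] by (simp add: funpow_mult Idt_funpow)

lemma period_ergodic:
  assumes "\<phi> \<in> BTY"
  shows "\<bar>((Idt v1 v2 \<sigma> N ^^ N) ^^ n) \<phi> \<tau> x - (\<integral>x'. \<phi> \<tau> x' \<partial>pi_inv v1 v2 \<sigma> N \<tau>)\<bar>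
    \<le> 2 * supnorm \<phi> * exp (- \<delta> * real (N * n))"
  unfolding Idt_period_funpow[OF assms]
  by (rule evolve_minus_integral_le[OF pi_inv BTY_slice[OF assms] BTY_le_supnorm[OF assms]])

text \<open>The \<open>i\<close> steps are split into a remainder of \<open>j\<close> steps followed
  by \<open>n\<close> whole periods. The periods start at time \<open>s\<close>, where
  \<open>\<phi> s\<close> is centred and decays; the remainder preserves the bound.\<close>

lemma centred_chain_exp_le:
  assumes \<phi>: "\<phi> \<in> BTY" and centred: "\<And>s. (\<integral>x. \<phi> s x \<partial>pi_inv v1 v2 \<sigma> N s) = 0"
  shows "\<bar>chain_exp v1 v2 \<sigma> N \<tau> x i (\<phi> (\<tau> + real i / real N))\<bar>
    \<le> 2 * supnorm \<phi> * exp (\<delta> * real N) * exp (- \<delta>) ^ i"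
proof -
  define n j where "n = i div N" and "j = i mod N"
  define s where "s = \<tau> + real j / real N"
  have i: "i = j + N * n" by (simp add: n_def j_def)
  have j: "j < N" using N_pos by (simp add: j_def)
  have K: "0 \<le> supnorm \<phi>" using BTY_le_supnorm[OF \<phi>, of 0 0] by simp
  have "\<tau> + real i / real N = s + real n"
    using N_pos by (simp add: i s_def add_divide_distrib)
  then have \<phi>s: "\<phi> (\<tau> + real i / real N) = \<phi> s" using BTY_per_nat[OF \<phi>] by simp
  have "\<bar>evolve s (N * n) (\<phi> s) y\<bar> \<le> 2 * supnorm \<phi> * exp (- \<delta> * real (N * n))" for y
    using evolve_minus_integral_le[OF pi_inv[of s] BTY_slice[OF \<phi>, of s] BTY_le_supnorm[OF \<phi>], of n y]
    by (simp add: centred)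
  then have "- (2 * supnorm \<phi> * exp (- \<delta> * real (N * n))) \<le> evolve s (N * n) (\<phi> s) y"
      "evolve s (N * n) (\<phi> s) y \<le> 2 * supnorm \<phi> * exp (- \<delta> * real (N * n))" for y
    by (meson abs_le_D1 abs_le_D2 minus_le_iff)+
  from evolve_bounds[OF evolve_in_BY[OF BTY_slice[OF \<phi>]] this, of \<tau> j x]
  have "\<bar>evolve \<tau> j (evolve s (N * n) (\<phi> s)) x\<bar> \<le> 2 * supnorm \<phi> * exp (- \<delta> * real (N * n))"
    by linarith
  \<comment> \<open>Since \<open>j < N\<close>, the periods contain more than \<open>i - N\<close>
    steps; \<open>exp (\<delta> * real N)\<close> pays for the missing ones.\<close>
  also have "\<dots> \<le> 2 * supnorm \<phi> * exp (\<delta> * real N + real i * (- \<delta>))"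
    using K delta_pos j by (intro mult_left_mono) (auto simp: i algebra_simps)
  also have "exp (\<delta> * real N + real i * (- \<delta>)) = exp (\<delta> * real N) * exp (- \<delta>) ^ i"
    by (simp only: exp_add exp_of_nat_mult)
  also have "evolve \<tau> j (evolve s (N * n) (\<phi> s)) x
      = chain_exp v1 v2 \<sigma> N \<tau> x i (\<phi> (\<tau> + real i / real N))"
    unfolding chain_exp_eq_evolve[OF BTY_slice[OF \<phi>]] \<phi>s by (simp add: i evolve_add s_def)
  finally show ?thesis by (simp add: mult.assoc)
qed

lemma centred_series_convergent:
  assumes \<phi>: "\<phi> \<in> BTY" and centred: "\<And>s. (\<integral>x. \<phi> s x \<partial>pi_inv v1 v2 \<sigma> N s) = 0"
  shows "convergent (\<lambda>m. \<Sum>i=1..m. chain_exp v1 v2 \<sigma> N \<tau> x i (\<phi> (\<tau> + real i / real N)))"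
proof -
  let ?g = "\<lambda>i. chain_exp v1 v2 \<sigma> N \<tau> x i (\<phi> (\<tau> + real i / real N))"
  have "summable (\<lambda>i. 2 * supnorm \<phi> * exp (\<delta> * real N) * exp (- \<delta>) ^ i)"
    using delta_pos by (intro summable_mult summable_geometric) simp
  then have "summable ?g"
    by (rule summable_comparison_test'[of _ 0]) (use centred_chain_exp_le[OF assms] in auto)
  \<comment> \<open>The series starts at \<open>i = 1\<close>.\<close>
  then have "summable (\<lambda>i. ?g (Suc i))" by (subst summable_Suc_iff)
  then have "convergent (\<lambda>m. \<Sum>i<m. ?g (Suc i))" by (simp add: summable_iff_convergent)
  then show ?thesis by (simp add: sum.atLeast1_atMost_eq)
qed

text \<open>A fixed function is fixed by all powers, so its distance to its spatial average is
  independent of \<open>n\<close> and yet tends to \<open>0\<close>.\<close>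

lemma period_kernel:
  assumes w: "w \<in> BTY"
  shows "(\<lambda>\<tau> x. w \<tau> x - (Idt v1 v2 \<sigma> N ^^ N) w \<tau> x) = (\<lambda>_ _. 0)
    \<longleftrightarrow> (\<exists>c. (\<forall>\<tau>. c (\<tau> + 1) = c \<tau>) \<and> (\<forall>\<tau> x. w \<tau> x = c \<tau>))"
proof
  assume "(\<lambda>\<tau> x. w \<tau> x - (Idt v1 v2 \<sigma> N ^^ N) w \<tau> x) = (\<lambda>_ _. 0)"
  then have fix1: "(Idt v1 v2 \<sigma> N ^^ N) w = w" by (auto simp: fun_eq_iff)
  have fixn: "((Idt v1 v2 \<sigma> N ^^ N) ^^ n) w = w" for n
    by (induction n) (simp_all add: fix1)
  have const: "w \<tau> x = (\<integral>x'. w \<tau> x' \<partial>pi_inv v1 v2 \<sigma> N \<tau>)" for \<tau> x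
  proof -
    have "(\<lambda>n. w \<tau> x - (\<integral>x'. w \<tau> x' \<partial>pi_inv v1 v2 \<sigma> N \<tau>)) \<longlonglongrightarrow> 0"
      by (rule Lim_null_comparison[OF _ exp_delta_tendsto[of "2 * supnorm w"]])
         (use period_ergodic[OF w, of _ \<tau> x] in \<open>simp add: fixn\<close>)
    then show ?thesis by (simp add: LIMSEQ_const_iff)
  qed
  show "\<exists>c. (\<forall>\<tau>. c (\<tau> + 1) = c \<tau>) \<and> (\<forall>\<tau> x. w \<tau> x = c \<tau>)"
  proof (intro exI conjI allI)
    show "w (\<tau> + 1) 0 = w \<tau> 0" for \<tau> using BTY_per_nat[OF w, of \<tau> 1] by simp
    show "w \<tau> x = w \<tau> 0" for \<tau> x using const[of \<tau> x] const[of \<tau> 0] by simp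
  qed
next
  assume "\<exists>c. (\<forall>\<tau>. c (\<tau> + 1) = c \<tau>) \<and> (\<forall>\<tau> x. w \<tau> x = c \<tau>)"
  then obtain c where c: "\<And>\<tau> x. w \<tau> x = c \<tau>" by blast
  have "(Idt v1 v2 \<sigma> N ^^ N) w \<tau> x = w \<tau> x" for \<tau> x
    \<comment> \<open>A spatially constant slice has its values in an interval of length
      \<open>0\<close>, which the evolution preserves.\<close>
    using evolve_bounds[OF BTY_slice[OF w, of \<tau>], of "c \<tau>" "c \<tau>" \<tau> N x]
      Idt_period_funpow[OF w, of 1 \<tau>] c by simp
  then show "(\<lambda>\<tau> x. w \<tau> x - (Idt v1 v2 \<sigma> N ^^ N) w \<tau> x) = (\<lambda>_ _. 0)" by simp
qed

end

section \<open>From smooth velocities to the conclusion\<close>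

lemma smooth2_imp_measurable:
  assumes "smooth2 v"
  shows "v t \<in> borel_measurable borel"
proof -
  \<comment> \<open>The empty list of derivatives gives joint differentiability of \<open>v\<close>
    itself.\<close>
  have "(\<lambda>p. v (fst p) (snd p)) differentiable (at z)" for z
    using assms[unfolded smooth2_def, rule_format, of "[]"] by simp
  then have "continuous_on UNIV (\<lambda>p. v (fst p) (snd p))"
    by (simp add: continuous_at_imp_continuous_on differentiable_imp_continuous_within)
  moreover have "continuous_on UNIV (\<lambda>y::real. (t, y))"
    by (intro continuous_intros)
  ultimately have "continuous_on UNIV (v t)"
    using continuous_on_compose2[of UNIV "\<lambda>p. v (fst p) (snd p)" UNIV "\<lambda>y. (t, y)"] by simp
  then show ?thesis by (rule borel_measurable_continuous_onI)
qed

theorem theorem4p2: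
  fixes v1 v2 :: "real \<Rightarrow> real \<Rightarrow> real" and \<sigma> :: real and N :: nat
  assumes sigma_pos: "\<sigma> > 0"
    and N_pos: "N > 0"
    and v1_smooth: "smooth2 v1" and v2_smooth: "smooth2 v2"
    and v1_per: "\<forall>t y. v1 (t + 1) y = v1 t y \<and> v1 t (y + 1) = v1 t y"
    and v2_per: "\<forall>t y. v2 (t + 1) y = v2 t y \<and> v2 t (y + 1) = v2 t y"
    and v1_mean: "\<forall>t. integral {0..1} (\<lambda>y. v1 t y) = 0"
    and v2_mean: "\<forall>t. integral {0..1} (\<lambda>y. v2 t y) = 0"
  shows
    "(\<exists>C>0. \<exists>\<rho>>0. \<forall>\<phi>\<in>BTY. \<forall>n::nat. \<forall>\<tau> x.
        \<bar>((Idt v1 v2 \<sigma> N ^^ N) ^^ n) \<phi> \<tau> x - (\<integral>x'. \<phi> \<tau> x' \<partial>pi_inv v1 v2 \<sigma> N \<tau>)\<bar>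
          \<le> C * supnorm \<phi> * exp (- \<rho> * real n))
   \<and> (\<forall>\<phi>\<in>BTY. (\<forall>s. (\<integral>x. \<phi> s x \<partial>pi_inv v1 v2 \<sigma> N s) = 0) \<longrightarrow>
        (\<forall>\<tau> x. convergent (\<lambda>m. \<Sum>i=1..m.
            chain_exp v1 v2 \<sigma> N \<tau> x i (\<phi> (\<tau> + real i / real N)))))
   \<and> {w \<in> BTY. (\<lambda>\<tau> x. w \<tau> x - (Idt v1 v2 \<sigma> N ^^ N) w \<tau> x) = (\<lambda>_ _. 0)}
       = {w \<in> BTY. \<exists>c. (\<forall>\<tau>. c (\<tau> + 1) = c \<tau>) \<and> (\<forall>\<tau> x. w \<tau> x = c \<tau>)}"
proof -
  interpret splitting_scheme v1 v2 \<sigma> N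
    using sigma_pos N_pos v1_per v2_per smooth2_imp_measurable[OF v1_smooth] smooth2_imp_measurable[OF v2_smooth]
    by unfold_locales auto
  show ?thesis
  proof (intro conjI)
    \<comment> \<open>A period consists of \<open>N\<close> contractions by
      \<open>exp (- \<delta>)\<close>, whence the rate \<open>\<delta> * real N\<close>. The
      constant \<open>2\<close> arises because the values of \<open>\<phi>\<close> fill at most an
      interval of length \<open>2 * supnorm \<phi>\<close>.\<close>
    have "\<bar>((Idt v1 v2 \<sigma> N ^^ N) ^^ n) \<phi> \<tau> x - (\<integral>x'. \<phi> \<tau> x' \<partial>pi_inv v1 v2 \<sigma> N \<tau>)\<bar>
          \<le> 2 * supnorm \<phi> * exp (- (\<delta> * real N) * real n)" if "\<phi> \<in> BTY" for \<phi> n \<tau> x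
      using period_ergodic[OF that, of n \<tau> x] by (simp add: mult.assoc)
    moreover have "\<delta> * real N > 0" using delta_pos N_pos by simp
    ultimately show "\<exists>C>0. \<exists>\<rho>>0. \<forall>\<phi>\<in>BTY. \<forall>n::nat. \<forall>\<tau> x.
        \<bar>((Idt v1 v2 \<sigma> N ^^ N) ^^ n) \<phi> \<tau> x - (\<integral>x'. \<phi> \<tau> x' \<partial>pi_inv v1 v2 \<sigma> N \<tau>)\<bar>
          \<le> C * supnorm \<phi> * exp (- \<rho> * real n)"
      by (intro exI[of _ 2] exI[of _ "\<delta> * real N"] conjI ballI allI) auto
  qed (use centred_series_convergent period_kernel in blast)+
qed

end
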